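(* The suggested matching algorithm achieves approximation factor $1-\frac1e$ with high probability: for every instance and every $\epsilon>0$, with probability $1-e^{-\Omega(n)}$ over the draws, $\mathrm{ALG}\ge (1-\frac1e)|A^*|-\epsilon n$ and $\mathrm{OPT}\le |A^*|+\epsilon n$, where $A^*$ is the set of advertisers carrying flow in the computed maximum flow. Moreover this is tight, even in expectation: there is a family of instances (with $e_i=1$ for all $i$ and $G$ the complete bipartite graph with $|A|=|I|=n$) on which the algorithm obtains $\approx(1-\frac1e)n$ with high probability while $\mathrm{OPT}=n$.
   Context: Online stochastic matching problem: an instance $\Gamma=(G,D,n)$ consists of a bipartite graph $G=(A,I,E)$ with advertisers $A$ and impression types $I$, a positive integer $e_i$ for each $i\in I$, $n=\sum_{i\in I}e_i$, and the distribution $D$ on $I$ with $\Pr[i]=e_i/n$, all known in advance. Online, $n$ i.i.d. draws $i\sim D$ arrive; each arriving impression of type $i$ must be immediately and irrevocably assigned to an unassigned advertiser $a$ with $(a,i)\in E$, or left unassigned; each advertiser is assigned at most once. $\mathrm{ALG}$ is the number of assigned impressions; $\mathrm{OPT}$ is the maximum matching size in the realization graph (vertex sets $A$ and the drawn impressions, with an edge between $a$ and a drawn copy of $i$ iff $(a,i)\in E$). An algorithm achieves approximation factor $\alpha$ with high probability if for every instance, with high probability, $\mathrm{ALG}/\mathrm{OPT}\ge\alpha$ (up to the stated $\epsilon$ errors). Suggested matching algorithm: Offline, build a flow network with source $s$, an edge $(s,a)$ of capacity $1$ for each $a\in A$, the edges of $E$ directed from $A$ to $I$, and an edge $(i,t)$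 of capacity $e_i$ to a sink $t$ for each $i\in I$; compute an integral maximum $s$-$t$ flow $f$, with $f_{ai}\in\{0,1\}$ the flow on $(a,i)$ ($f_{ai}=0$ if $(a,i)\notin E$). Let $A^*=\{a: \sum_i f_{ai}=1\}$. Online, when an impression of type $i$ arrives, choose advertiser $a'$ with probability $f_{a'i}/e_i$ (with the remaining probability choose none); assign the impression to $a'$ if $a'$ is still unassigned, otherwise do not assign it. *)

theory Defs
  imports "HOL-Probability.Probability"
begin

section \<open>Instances\<close>

record ('a, 'i) osm_instance =
  advertisers :: "'a set"
  impressions :: "'i set"
  allowed :: "('a \<times> 'i) set"
  expected :: "'i \<Rightarrow> nat"

definition num_draws :: "('a, 'i) osm_instance \<Rightarrow> nat" where
  "num_draws \<Gamma> = (\<Sum>i\<in>impressions \<Gamma>. expected \<Gamma> i)"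

text \<open>There must be at least one impression type, since otherwise the draw distribution
  does not exist.\<close>

definition valid_instance :: "('a, 'i) osm_instance \<Rightarrow> bool" where
  "valid_instance \<Gamma> \<longleftrightarrow>
     finite (advertisers \<Gamma>) \<and> finite (impressions \<Gamma>) \<and> impressions \<Gamma> \<noteq> {} \<and>
     allowed \<Gamma> \<subseteq> advertisers \<Gamma> \<times> impressions \<Gamma> \<and>
     (\<forall>i\<in>impressions \<Gamma>. expected \<Gamma> i > 0)"

definition draw_pmf :: "('a, 'i) osm_instance \<Rightarrow> 'i pmf" where
  "draw_pmf \<Gamma> = embed_pmf (\<lambda>i. if i \<in> impressions \<Gamma>
     then real (expected \<Gamma> i) / real (num_draws \<Gamma>) else 0)"


section \<open>Flows\<close>

text \<open>A network is given by a finite vertex set and a capacity function; capacity 0 means that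
  there is no edge, so that a flow vanishes off the edges, and capacity \<open>\<infinity>\<close> means that the edge
  is uncapacitated.\<close>

definition is_flow :: "'v set \<Rightarrow> ('v \<Rightarrow> 'v \<Rightarrow> ereal) \<Rightarrow> 'v \<Rightarrow> 'v \<Rightarrow> ('v \<Rightarrow> 'v \<Rightarrow> real) \<Rightarrow> bool" where
  "is_flow V c s t f \<longleftrightarrow>
     (\<forall>u v. 0 \<le> f u v \<and> ereal (f u v) \<le> c u v) \<and>
     (\<forall>v\<in>V - {s, t}. (\<Sum>u\<in>V. f u v) = (\<Sum>u\<in>V. f v u))"

definition flow_value :: "'v set \<Rightarrow> 'v \<Rightarrow> ('v \<Rightarrow> 'v \<Rightarrow> real) \<Rightarrow> real" where
  "flow_value V s f = (\<Sum>v\<in>V. f s v) - (\<Sum>v\<in>V. f v s)"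

definition is_max_flow :: "'v set \<Rightarrow> ('v \<Rightarrow> 'v \<Rightarrow> ereal) \<Rightarrow> 'v \<Rightarrow> 'v \<Rightarrow> ('v \<Rightarrow> 'v \<Rightarrow> real) \<Rightarrow> bool" where
  "is_max_flow V c s t f \<longleftrightarrow> is_flow V c s t f \<and>
     (\<forall>g. is_flow V c s t g \<longrightarrow> flow_value V s g \<le> flow_value V s f)"

datatype ('a, 'i) vertex = Source | Adv 'a | Imp 'i | Sink

definition net_vertices :: "('a, 'i) osm_instance \<Rightarrow> ('a, 'i) vertex set" where
  "net_vertices \<Gamma> = {Source, Sink} \<union> Adv ` advertisers \<Gamma> \<union> Imp ` impressions \<Gamma>"

fun net_cap :: "('a, 'i) osm_instance \<Rightarrow> ('a, 'i) vertex \<Rightarrow> ('a, 'i) vertex \<Rightarrow> ereal" where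
  "net_cap \<Gamma> Source (Adv a) = (if a \<in> advertisers \<Gamma> then 1 else 0)"
| "net_cap \<Gamma> (Adv a) (Imp i) = (if (a, i) \<in> allowed \<Gamma> then \<infinity> else 0)"
| "net_cap \<Gamma> (Imp i) Sink = (if i \<in> impressions \<Gamma> then ereal (real (expected \<Gamma> i)) else 0)"
| "net_cap \<Gamma> _ _ = 0"

type_synonym ('a, 'i) net_flow = "('a, 'i) vertex \<Rightarrow> ('a, 'i) vertex \<Rightarrow> real"

definition integral_max_flow :: "('a, 'i) osm_instance \<Rightarrow> ('a, 'i) net_flow \<Rightarrow> bool" where
  "integral_max_flow \<Gamma> f \<longleftrightarrow>
     is_max_flow (net_vertices \<Gamma>) (net_cap \<Gamma>) Source Sink f \<and> (\<forall>u v. f u v \<in> \<int>)"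

definition flow_advertisers :: "('a, 'i) osm_instance \<Rightarrow> ('a, 'i) net_flow \<Rightarrow> 'a set" where
  "flow_advertisers \<Gamma> f =
     {a \<in> advertisers \<Gamma>. (\<Sum>i\<in>impressions \<Gamma>. f (Adv a) (Imp i)) = 1}"


section \<open>The online algorithm\<close>

definition choice_pmf :: "('a, 'i) osm_instance \<Rightarrow> ('a, 'i) net_flow \<Rightarrow> 'i \<Rightarrow> 'a option pmf" where
  "choice_pmf \<Gamma> f i = embed_pmf (\<lambda>x. case x of
       Some a \<Rightarrow> if a \<in> advertisers \<Gamma> then f (Adv a) (Imp i) / real (expected \<Gamma> i) else 0
     | None \<Rightarrow> 1 - (\<Sum>a\<in>advertisers \<Gamma>. f (Adv a) (Imp i) / real (expected \<Gamma> i)))"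

text \<open>The argument \<open>U\<close> is the set of advertisers that are already assigned. The result lists, for
  every arriving impression in order, the advertiser to which it is assigned, if any.\<close>

primrec suggested_matching ::
    "('a, 'i) osm_instance \<Rightarrow> ('a, 'i) net_flow \<Rightarrow> 'a set \<Rightarrow> 'i list \<Rightarrow> 'a option list pmf" where
  "suggested_matching \<Gamma> f U [] = return_pmf []"
| "suggested_matching \<Gamma> f U (i # js) =
     bind_pmf (choice_pmf \<Gamma> f i) (\<lambda>x.
       let y = (case x of None \<Rightarrow> None | Some a \<Rightarrow> if a \<in> U then None else Some a)
       in map_pmf (\<lambda>ys. y # ys) (suggested_matching \<Gamma> f (U \<union> set_option y) js))"

text \<open>Joint distribution of the drawn impressions and the assignments made by an algorithm.\<close>

definition outcome_pmf ::
    "('a, 'i) osm_instance \<Rightarrow> ('i list \<Rightarrow> 'a option list pmf) \<Rightarrow> ('i list \<times> 'a option list) pmf" where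
  "outcome_pmf \<Gamma> alg =
     bind_pmf (replicate_pmf (num_draws \<Gamma>) (draw_pmf \<Gamma>)) (\<lambda>js.
       map_pmf (\<lambda>ys. (js, ys)) (alg js))"

abbreviation suggested_outcome_pmf ::
    "('a, 'i) osm_instance \<Rightarrow> ('a, 'i) net_flow \<Rightarrow> ('i list \<times> 'a option list) pmf" where
  "suggested_outcome_pmf \<Gamma> f \<equiv> outcome_pmf \<Gamma> (suggested_matching \<Gamma> f {})"

definition ALG :: "'a option list \<Rightarrow> nat" where
  "ALG ys = length (filter (\<lambda>y. y \<noteq> None) ys)"


section \<open>The offline optimum\<close>

text \<open>The right-hand vertices of the realization graph are the positions in the list of draws, so
  that repeated draws of one type are distinct vertices.\<close>

definition realization_edges :: "('a, 'i) osm_instance \<Rightarrow> 'i list \<Rightarrow> ('a \<times> nat) set" where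
  "realization_edges \<Gamma> js = {(a, j). j < length js \<and> (a, js ! j) \<in> allowed \<Gamma>}"

definition bipartite_matching :: "('a \<times> 'b) set \<Rightarrow> ('a \<times> 'b) set \<Rightarrow> bool" where
  "bipartite_matching E M \<longleftrightarrow> M \<subseteq> E \<and> inj_on fst M \<and> inj_on snd M"

definition OPT :: "('a, 'i) osm_instance \<Rightarrow> 'i list \<Rightarrow> nat" where
  "OPT \<Gamma> js = Max {card M | M. bipartite_matching (realization_edges \<Gamma> js) M}"


section \<open>Approximation with high probability\<close>

text \<open>\<open>ALG / OPT \<ge> \<alpha>\<close> is required up to an additive error of \<open>\<epsilon> n\<close>, with failure
  probability \<open>exp (- \<Omega>(n))\<close>; the constants depend on \<open>\<epsilon>\<close> but not on the instance.\<close>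

definition achieves_factor_whp ::
    "(('a, 'i) osm_instance \<Rightarrow> 'i list \<Rightarrow> 'a option list pmf) \<Rightarrow> real \<Rightarrow> bool" where
  "achieves_factor_whp alg \<alpha> \<longleftrightarrow>
     (\<forall>\<epsilon>>0. \<exists>c>0. \<exists>N. \<forall>\<Gamma>. valid_instance \<Gamma> \<and> num_draws \<Gamma> \<ge> N \<longrightarrow>
        measure_pmf.prob (outcome_pmf \<Gamma> (alg \<Gamma>))
          {(js, ys). real (ALG ys) \<ge> \<alpha> * real (OPT \<Gamma> js) - \<epsilon> * real (num_draws \<Gamma>)}
        \<ge> 1 - exp (- c * real (num_draws \<Gamma>)))"


section \<open>Well-definedness of the distributions\<close>

lemma embed_pmf_finite:
  assumes "finite S" "\<And>x. f x \<ge> 0" "\<And>x. x \<notin> S \<Longrightarrow> f x = 0" "sum f S = 1"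
  shows "pmf (embed_pmf f) x = f x"
proof (rule pmf_embed_pmf)
  have "(\<integral>\<^sup>+x. ennreal (f x) \<partial>count_space UNIV) = (\<Sum>x\<in>S. ennreal (f x))"
    using assms(1,3) by (subst nn_integral_count_space'[of S]) auto
  also have "\<dots> = 1"
    using assms(2,4) by (simp add: sum_ennreal)
  finally show "(\<integral>\<^sup>+x. ennreal (f x) \<partial>count_space UNIV) = 1" .
qed (use assms in auto)

lemma num_draws_pos: "valid_instance \<Gamma> \<Longrightarrow> num_draws \<Gamma> > 0"
  by (auto simp: valid_instance_def num_draws_def intro!: sum_pos)

lemma pmf_draw_pmf:
  assumes "valid_instance \<Gamma>"
  shows "pmf (draw_pmf \<Gamma>) i =
    (if i \<in> impressions \<Gamma> then real (expected \<Gamma> i) / real (num_draws \<Gamma>) else 0)"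
proof -
  have "(\<Sum>i\<in>impressions \<Gamma>. real (expected \<Gamma> i) / real (num_draws \<Gamma>)) = 1"
    using num_draws_pos[OF assms] by (simp add: num_draws_def flip: sum_divide_distrib of_nat_sum)
  then show ?thesis
    using assms unfolding draw_pmf_def
    by (subst embed_pmf_finite[of "impressions \<Gamma>"]) (auto simp: valid_instance_def)
qed

lemma pmf_choice_pmf:
  assumes \<Gamma>: "valid_instance \<Gamma>" and f: "integral_max_flow \<Gamma> f" and i: "i \<in> impressions \<Gamma>"
  shows "pmf (choice_pmf \<Gamma> f i) x = (case x of
       Some a \<Rightarrow> if a \<in> advertisers \<Gamma> then f (Adv a) (Imp i) / real (expected \<Gamma> i) else 0
     | None \<Rightarrow> 1 - (\<Sum>a\<in>advertisers \<Gamma>. f (Adv a) (Imp i) / real (expected \<Gamma> i)))"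
proof -
  let ?V = "net_vertices \<Gamma>"
  have fin: "finite (advertisers \<Gamma>)" "finite ?V" and e: "expected \<Gamma> i > 0"
    using \<Gamma> i by (auto simp: valid_instance_def net_vertices_def)
  have nonneg: "f u v \<ge> 0" and cap: "ereal (f u v) \<le> net_cap \<Gamma> u v" for u v
    using f by (auto simp: integral_max_flow_def is_max_flow_def is_flow_def)
  have zero: "f u v = 0" if "net_cap \<Gamma> u v = 0" for u v
    using nonneg[of u v] cap[of u v] that by simp
  have "(\<Sum>a\<in>advertisers \<Gamma>. f (Adv a) (Imp i)) = (\<Sum>u\<in>Adv ` advertisers \<Gamma>. f u (Imp i))"
    by (subst sum.reindex) (auto simp: inj_on_def)
  also have "\<dots> \<le> (\<Sum>u\<in>?V. f u (Imp i))"
    using fin nonneg by (intro sum_mono2) (auto simp: net_vertices_def)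
  also have "\<dots> = (\<Sum>u\<in>?V. f (Imp i) u)"
    using f i by (auto simp: integral_max_flow_def is_max_flow_def is_flow_def net_vertices_def)
  also have "\<dots> = (\<Sum>u\<in>{Sink}. f (Imp i) u)"
  proof (rule sum.mono_neutral_right)
    show "\<forall>u\<in>?V - {Sink}. f (Imp i) u = 0"
    proof
      fix u assume "u \<in> ?V - {Sink}"
      then show "f (Imp i) u = 0"
        by (cases u) (auto intro!: zero)
    qed
  qed (use fin in \<open>auto simp: net_vertices_def\<close>)
  also have "\<dots> \<le> real (expected \<Gamma> i)"
    using cap[of "Imp i" Sink] i by simp
  finally have le: "(\<Sum>a\<in>advertisers \<Gamma>. f (Adv a) (Imp i) / real (expected \<Gamma> i)) \<le> 1"
    using e by (simp flip: sum_divide_distrib)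
  have sum_eq: "sum h (insert None (Some ` advertisers \<Gamma>)) =
      h None + (\<Sum>a\<in>advertisers \<Gamma>. h (Some a))" for h :: "'a option \<Rightarrow> real"
    using fin by (subst sum.insert) (auto simp: sum.reindex)
  show ?thesis
    unfolding choice_pmf_def
  proof (rule embed_pmf_finite[of "insert None (Some ` advertisers \<Gamma>)"], goal_cases)
    case 1
    then show ?case using fin by simp
  next
    case (2 x)
    then show ?case using le nonneg by (auto split: option.splits)
  next
    case (3 x)
    then show ?case by (auto split: option.splits)
  next
    case 4
    then show ?case by (subst sum_eq) simp
  qed
qed

end

theory Submission
  imports Defs
begin

text \<open>The advertiser chosen for an arriving impression does not depend on the previous
  assignments, so the pairs of a drawn impression and its chosen advertiser are independent and
  identically distributed, and \<open>ALG\<close> is the number of distinct advertisers among them. Each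
  advertiser carrying flow is chosen in a given step with probability \<open>1 / n\<close>, so that the
  expectation of \<open>ALG\<close> is \<open>|A\<^sup>*| (1 - (1 - 1 / n) ^ n)\<close>. A minimum cut of the flow network is a
  vertex cover by advertisers \<open>B\<close> and impression types \<open>T\<close> of weight \<open>|B| + e(T) = |A\<^sup>*|\<close>; it
  bounds \<open>OPT\<close> by \<open>|B|\<close> plus the number of draws in \<open>T\<close>, whose expectation is \<open>e(T)\<close>. Both
  random variables change by at most 1 when one step is altered, so McDiarmid's inequality
  concentrates them.\<close>

section \<open>Concentration under bounded differences\<close>

lemma expectation_bind_pmf_finite:
  fixes h :: "'b \<Rightarrow> real"
  assumes "finite (set_pmf p)" "\<And>x. x \<in> set_pmf p \<Longrightarrow> finite (set_pmf (f x))"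
  shows "measure_pmf.expectation (bind_pmf p f) h =
    measure_pmf.expectation p (\<lambda>x. measure_pmf.expectation (f x) h)"
  using assms by (simp add: pmf_expectation_bind[of "set_pmf p"] integral_measure_pmf[of "set_pmf p"])

lemma finite_set_replicate_pmf: "finite (set_pmf p) \<Longrightarrow> finite (set_pmf (replicate_pmf n p))"
  by (induction n) auto

lemma expectation_replicate_pmf_Suc:
  fixes h :: "'b list \<Rightarrow> real"
  assumes "finite (set_pmf p)"
  shows "measure_pmf.expectation (replicate_pmf (Suc n) p) h =
    measure_pmf.expectation p (\<lambda>z. measure_pmf.expectation (replicate_pmf n p) (\<lambda>zs. h (z # zs)))"
  using assms by (simp add: expectation_bind_pmf_finite finite_set_replicate_pmf)

text \<open>Hoeffding's lemma wants an interval containing the values. Oscillation at most 1 and a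
  finite support provide one of length 1 that starts at the minimum over the support, whence the
  exponent \<open>l\<^sup>2 / 8\<close>.\<close>

lemma Hoeffdings_lemma_pmf:
  fixes h :: "'b \<Rightarrow> real"
  assumes fin: "finite (set_pmf p)" and osc: "\<And>z z'. h z - h z' \<le> 1" and l: "l > 0"
  shows "measure_pmf.expectation p (\<lambda>z. exp (l * (h z - measure_pmf.expectation p h))) \<le> exp (l\<^sup>2 / 8)"
proof -
  define a where "a = Min (h ` set_pmf p)"
  have "a \<in> h ` set_pmf p"
    unfolding a_def using fin by (intro Min_in) (auto simp: set_pmf_not_empty)
  then obtain z0 where z0: "a = h z0" by auto
  interpret interval_bounded_random_variable "measure_pmf p" h a "a + 1"
    by unfold_locales (use fin osc[of _ z0] in \<open>auto simp: AE_measure_pmf_iff a_def simp flip: z0\<close>,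
        smt (verit) osc z0 a_def)
  have int: "integrable (measure_pmf p) k" for k :: "'b \<Rightarrow> real"
    using fin by (rule integrable_measure_pmf_finite)
  have "ennreal (measure_pmf.expectation p (\<lambda>z. exp (l * (h z - measure_pmf.expectation p h)))) =
      (\<integral>\<^sup>+ z. exp (l * (h z - measure_pmf.expectation p h)) \<partial>p)"
    by (rule nn_integral_eq_integral[symmetric]) (auto simp: int)
  also have "\<dots> \<le> ennreal (exp (l\<^sup>2 / 8))"
    using Hoeffdings_lemma_nn_integral[OF l] by simp
  finally show ?thesis by simp
qed

text \<open>Induction that conditions on the first entry, that is, the Doob martingale unrolled. The
  hypothesis on \<open>g\<close> ranges over all prefixes, so it passes to \<open>g (z # _)\<close>;
  each entry contributes one factor \<open>exp (l\<^sup>2 / 8)\<close> by Hoeffding's lemma.\<close>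

lemma bounded_differences_mgf:
  fixes g :: "'b list \<Rightarrow> real"
  assumes fin: "finite (set_pmf p)" and l: "l > 0"
    and "\<And>xs z z' ys. g (xs @ z # ys) - g (xs @ z' # ys) \<le> 1"
  shows "measure_pmf.expectation (replicate_pmf n p)
      (\<lambda>zs. exp (l * (g zs - measure_pmf.expectation (replicate_pmf n p) g))) \<le> exp (l\<^sup>2 * n / 8)"
  using assms(3)
proof (induction n arbitrary: g)
  case 0
  then show ?case by simp
next
  case (Suc n)
  let ?E = "measure_pmf.expectation (replicate_pmf n p)"
  have int: "integrable (measure_pmf p) k" for k :: "'b \<Rightarrow> real"
    using fin by (rule integrable_measure_pmf_finite)
  have int': "integrable (measure_pmf (replicate_pmf n p)) k" for k :: "'b list \<Rightarrow> real"
    using fin by (intro integrable_measure_pmf_finite finite_set_replicate_pmf)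
  define h where "h z = ?E (\<lambda>zs. g (z # zs))" for z
  define m where "m = measure_pmf.expectation p h"
  have m: "measure_pmf.expectation (replicate_pmf (Suc n) p) g = m"
    unfolding expectation_replicate_pmf_Suc[OF fin] m_def h_def ..
  have IH: "?E (\<lambda>zs. exp (l * (g (z # zs) - h z))) \<le> exp (l\<^sup>2 * n / 8)" for z
    unfolding h_def using Suc.prems[of "z # _"] by (intro Suc.IH) simp
  \<comment> \<open>Both conditional expectations average over the same tail, so the bounded
    difference at the first position applies inside the expectation.\<close>
  have osc: "h z - h z' \<le> 1" for z z'
  proof -
    have "h z - h z' = ?E (\<lambda>zs. g (z # zs) - g (z' # zs))"
      unfolding h_def by (simp add: int')
    also have "\<dots> \<le> ?E (\<lambda>_. 1)"
      using Suc.prems[of "[]"] by (intro integral_mono int') simp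
    finally show ?thesis by simp
  qed
  \<comment> \<open>Splitting the exponent at \<open>h z\<close> leaves one factor that is constant
    in the tail and one that the induction hypothesis bounds.\<close>
  have "?E (\<lambda>zs. exp (l * (g (z # zs) - m))) \<le> exp (l\<^sup>2 * n / 8) * exp (l * (h z - m))" for z
  proof -
    have "?E (\<lambda>zs. exp (l * (g (z # zs) - m))) =
        ?E (\<lambda>zs. exp (l * (g (z # zs) - h z)) * exp (l * (h z - m)))"
      by (simp add: algebra_simps flip: exp_add)
    also have "\<dots> \<le> exp (l\<^sup>2 * n / 8) * exp (l * (h z - m))"
      using IH[of z] by simp
    finally show ?thesis .
  qed
  then have "measure_pmf.expectation (replicate_pmf (Suc n) p) (\<lambda>zs. exp (l * (g zs - m))) \<le>
      measure_pmf.expectation p (\<lambda>z. exp (l\<^sup>2 * n / 8) * exp (l * (h z - m)))"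
    unfolding expectation_replicate_pmf_Suc[OF fin] by (intro integral_mono int)
  also have "\<dots> \<le> exp (l\<^sup>2 * n / 8) * exp (l\<^sup>2 / 8)"
    using Hoeffdings_lemma_pmf[OF fin osc l] by (simp add: m_def)
  also have "\<dots> = exp (l\<^sup>2 * Suc n / 8)"
    by (simp add: field_simps flip: exp_add)
  finally show ?case unfolding m .
qed

text \<open>Chernoff's method: Markov's inequality for the exponential moment bounded above.\<close>

lemma McDiarmid_upper:
  fixes g :: "'b list \<Rightarrow> real"
  assumes fin: "finite (set_pmf p)" and \<epsilon>: "\<epsilon> > 0"
    and bd: "\<And>xs z z' ys. g (xs @ z # ys) - g (xs @ z' # ys) \<le> 1"
  shows "measure_pmf.prob (replicate_pmf n p)
      {zs. g zs \<ge> measure_pmf.expectation (replicate_pmf n p) g + \<epsilon> * n} \<le> exp (- 2 * \<epsilon>\<^sup>2 * n)"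
proof -
  let ?R = "replicate_pmf n p"
  define m where "m = measure_pmf.expectation ?R g"
  \<comment> \<open>The parameter \<open>l = 4 * \<epsilon>\<close> minimises
    \<open>l\<^sup>2 * n / 8 - l * \<epsilon> * n\<close>, with minimum
    \<open>- 2 * \<epsilon>\<^sup>2 * n\<close>.\<close>
  let ?Y = "\<lambda>zs. exp (4 * \<epsilon> * (g zs - m))"
  have "measure_pmf.prob ?R {zs. g zs \<ge> m + \<epsilon> * n} =
      measure_pmf.prob ?R {zs \<in> space (measure_pmf ?R). ?Y zs \<ge> exp (4 * \<epsilon> * (\<epsilon> * n))}"
    using \<epsilon> by (simp add: le_diff_eq add.commute)
  also have "\<dots> \<le> measure_pmf.expectation ?R ?Y / exp (4 * \<epsilon> * (\<epsilon> * n))"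
    using fin by (intro integral_Markov_inequality_measure[where A = "{}"]
        integrable_measure_pmf_finite finite_set_replicate_pmf) auto
  also have "\<dots> \<le> exp ((4 * \<epsilon>)\<^sup>2 * n / 8) / exp (4 * \<epsilon> * (\<epsilon> * n))"
    unfolding m_def using fin \<epsilon> bd by (intro divide_right_mono bounded_differences_mgf) auto
  also have "\<dots> = exp (- 2 * \<epsilon>\<^sup>2 * n)"
    by (simp add: power2_eq_square flip: exp_diff)
  finally show ?thesis by (simp add: m_def)
qed

text \<open>The difference condition is symmetric in \<open>z\<close> and \<open>z'\<close>, so it
  holds for \<open>- g\<close> as well.\<close>

lemma McDiarmid_lower:
  fixes g :: "'b list \<Rightarrow> real"
  assumes fin: "finite (set_pmf p)" and \<epsilon>: "\<epsilon> > 0"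
    and bd: "\<And>xs z z' ys. g (xs @ z # ys) - g (xs @ z' # ys) \<le> 1"
  shows "measure_pmf.prob (replicate_pmf n p)
      {zs. g zs \<le> measure_pmf.expectation (replicate_pmf n p) g - \<epsilon> * n} \<le> exp (- 2 * \<epsilon>\<^sup>2 * n)"
  using McDiarmid_upper[OF fin \<epsilon>, of "\<lambda>zs. - g zs" n] bd
  by (simp add: le_diff_eq algebra_simps)

section \<open>Minimum cuts\<close>

text \<open>The excess at a vertex. It is linear in \<open>f\<close>, so single-edge changes and
  convex combinations of flows can be tracked vertex by vertex.\<close>

definition net_inflow :: "'v set \<Rightarrow> ('v \<Rightarrow> 'v \<Rightarrow> real) \<Rightarrow> 'v \<Rightarrow> real" where
  "net_inflow V f v = (\<Sum>u\<in>V. f u v) - (\<Sum>u\<in>V. f v u)"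

lemma is_flow_iff_net_inflow:
  "is_flow V c s t f \<longleftrightarrow>
     (\<forall>u v. 0 \<le> f u v \<and> ereal (f u v) \<le> c u v) \<and> (\<forall>v\<in>V - {s, t}. net_inflow V f v = 0)"
  by (simp add: is_flow_def net_inflow_def)

lemma flow_value_eq_net_inflow: "flow_value V s f = - net_inflow V f s"
  by (simp add: flow_value_def net_inflow_def)

lemma sum_net_inflow: "(\<Sum>v\<in>V. net_inflow V f v) = 0"
  unfolding net_inflow_def sum_subtractf by (subst sum.swap) simp

text \<open>The sign of \<eta> is free: a negative value withdraws flow, which is how a residual
  edge against the flow is used.\<close>

lemma net_inflow_push:
  assumes "finite V" "u \<in> V" "w \<in> V" "v \<in> V"
  shows "net_inflow V (\<lambda>x y. f x y + (if x = u \<and> y = w then \<eta> else 0)) v =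
    net_inflow V f v + (if v = w then \<eta> else 0) - (if v = u then \<eta> else 0)"
proof -
  have "(\<Sum>x\<in>V. if x = u \<and> v = w then \<eta> else 0) = (if v = w then \<eta> else 0)"
    "(\<Sum>x\<in>V. if v = u \<and> x = w then \<eta> else 0) = (if v = u then \<eta> else 0)"
    using assms by (auto simp: if_distrib sum.delta cong: if_cong)
  then show ?thesis by (simp add: net_inflow_def sum.distrib)
qed

lemma net_inflow_convex:
  "net_inflow V (\<lambda>x y. \<kappa> * g x y + (1 - \<kappa>) * h x y) v =
    \<kappa> * net_inflow V g v + (1 - \<kappa>) * net_inflow V h v"
  by (simp add: net_inflow_def sum.distrib flip: sum_distrib_left) (simp add: algebra_simps)

lemma capacity_convex:
  fixes x y :: real and c :: ereal
  assumes "ereal x \<le> c" "ereal y \<le> c" "0 \<le> \<kappa>" "\<kappa> \<le> 1"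
  shows "ereal (\<kappa> * x + (1 - \<kappa>) * y) \<le> c"
proof -
  have "\<kappa> * x + (1 - \<kappa>) * y \<le> max x y"
    using assms by (intro convex_bound_le) auto
  then have "ereal (\<kappa> * x + (1 - \<kappa>) * y) \<le> ereal (max x y)" by (simp only: ereal_less_eq)
  also have "\<dots> \<le> c" using assms by (auto simp: max_def)
  finally show ?thesis .
qed

text \<open>Instead of searching for augmenting paths, take as source side of the cut all vertices to
  which some extra amount can be shipped from the source. Convex combinations of flows show
  that this set is closed under residual edges.\<close>

lemma max_flow_saturated_cut:
  assumes V: "finite V" "s \<in> V" "t \<in> V" "s \<noteq> t" and f: "is_max_flow V c s t f"
  obtains R where "R \<subseteq> V" "s \<in> R" "t \<notin> R"
    "\<And>u v. u \<in> R \<Longrightarrow> v \<in> V - R \<Longrightarrow> ereal (f u v) = c u v \<and> f v u = 0"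
proof -
  define feasible where "feasible h \<longleftrightarrow> (\<forall>u v. 0 \<le> h u v \<and> ereal (h u v) \<le> c u v)" for h
  \<comment> \<open>Away from the source, \<open>h\<close> differs from \<open>f\<close> in excess
    only by a surplus \<delta> at \<open>v\<close>. How the edges achieve this is left open, so no
    path has to be named.\<close>
  define ships where "ships v \<delta> h \<longleftrightarrow> feasible h \<and> \<delta> > 0 \<and>
      (\<forall>x\<in>V - {s}. net_inflow V h x = net_inflow V f x + (if x = v then \<delta> else 0))" for v \<delta> h
  define R where "R = {v \<in> V. v = s \<or> (\<exists>\<delta> h. ships v \<delta> h)}"
  have flow: "feasible f" "\<And>v. v \<in> V - {s, t} \<Longrightarrow> net_inflow V f v = 0"
    using f by (auto simp: is_max_flow_def is_flow_iff_net_inflow feasible_def)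
  \<comment> \<open>A surplus at the sink makes \<open>h\<close> a flow again. All excesses sum to
    0, so its value exceeds that of \<open>f\<close> by \<delta>, against maximality.\<close>
  have "t \<notin> R"
  proof
    assume "t \<in> R"
    then obtain \<delta> h where h: "ships t \<delta> h"
      using V by (auto simp: R_def)
    have "is_flow V c s t h"
      using h flow by (auto simp: ships_def is_flow_iff_net_inflow feasible_def)
    then have "flow_value V s h \<le> flow_value V s f"
      using f by (simp add: is_max_flow_def)
    moreover have "(\<Sum>v\<in>V - {s}. net_inflow V h v) = (\<Sum>v\<in>V - {s}. net_inflow V f v) + \<delta>"
      using h V by (simp add: ships_def sum.distrib)
    moreover have "net_inflow V k s = - (\<Sum>v\<in>V - {s}. net_inflow V k v)" for k
      using sum_net_inflow[of V k] V by (simp add: sum.remove[of V s])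
    ultimately show False
      using h by (simp add: flow_value_eq_net_inflow ships_def)
  qed
  \<comment> \<open>Here \<open>k\<close> is \<open>f\<close> with \<eta> moved from
    \<open>u\<close> to \<open>w\<close>. If \<open>u\<close> is not the source, \<open>k\<close>
    has a deficit at \<open>u\<close>, which is mixed with the surplus of a shipment
    \<open>h\<close> to \<open>u\<close>.\<close>
  have closed: "w \<in> R"
    if u: "u \<in> R" and w: "w \<in> V" "w \<noteq> s" and k: "feasible k" and "\<eta> > 0"
      and push: "\<And>v. v \<in> V \<Longrightarrow> net_inflow V k v =
        net_inflow V f v + (if v = w then \<eta> else 0) - (if v = u then \<eta> else 0)" for u w k \<eta>
  proof (cases "u = s")
    case True
    then have "ships w \<eta> k"
      using k push \<open>\<eta> > 0\<close> by (auto simp: ships_def)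
    then show ?thesis using w by (auto simp: R_def)
  next
    case False
    then obtain \<delta> h where h: "ships u \<delta> h" using u by (auto simp: R_def)
    \<comment> \<open>The weight for which surplus and deficit at \<open>u\<close> cancel, leaving
      \<open>(1 - \<kappa>) * \<eta>\<close> at \<open>w\<close>.\<close>
    define \<kappa> where "\<kappa> = \<eta> / (\<delta> + \<eta>)"
    have pos: "\<delta> > 0" using h by (simp add: ships_def)
    have \<kappa>: "0 < \<kappa>" "\<kappa> < 1" "\<kappa> * \<delta> = (1 - \<kappa>) * \<eta>"
      using pos \<open>\<eta> > 0\<close> by (auto simp: \<kappa>_def field_simps)
    have "feasible (\<lambda>x y. \<kappa> * h x y + (1 - \<kappa>) * k x y)"
      using h k \<kappa> by (auto simp: ships_def feasible_def intro!: capacity_convex)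
    moreover have "net_inflow V (\<lambda>x y. \<kappa> * h x y + (1 - \<kappa>) * k x y) v =
        net_inflow V f v + (if v = w then (1 - \<kappa>) * \<eta> else 0)" if "v \<in> V - {s}" for v
    proof -
      have "net_inflow V h v = net_inflow V f v + (if v = u then \<delta> else 0)"
        using h that by (auto simp: ships_def)
      moreover have "net_inflow V k v =
          net_inflow V f v + (if v = w then \<eta> else 0) - (if v = u then \<eta> else 0)"
        using push that by simp
      ultimately show ?thesis
        unfolding net_inflow_convex using \<kappa>(3) by (simp only:) (auto simp: algebra_simps)
    qed
    ultimately have "ships w ((1 - \<kappa>) * \<eta>) (\<lambda>x y. \<kappa> * h x y + (1 - \<kappa>) * k x y)"
      using \<kappa> \<open>\<eta> > 0\<close> by (auto simp: ships_def)
    then show ?thesis using w by (auto simp: R_def)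
  qed
  have "ereal (f u w) = c u w \<and> f w u = 0" if u: "u \<in> R" and w: "w \<in> V - R" for u w
  proof (rule ccontr)
    assume neg: "\<not> ?thesis"
    have uw: "u \<in> V" "w \<in> V" "w \<noteq> s" using u w V by (auto simp: R_def)
    have box: "0 \<le> f x y" "ereal (f x y) \<le> c x y" for x y
      using flow by (auto simp: feasible_def)
    consider "ereal (f u w) < c u w" | "f w u > 0"
      using neg box[of u w] box[of w u] by fastforce
    then show False
    proof cases
      case 1
      \<comment> \<open>The capacity may be infinite, so a real number strictly between flow and
        capacity replaces the residual capacity.\<close>
      obtain b where b: "f u w < b" "ereal b \<le> c u w"
        using ereal_dense2[OF 1] by auto
      have "feasible (\<lambda>x y. f x y + (if x = u \<and> y = w then b - f u w else 0))"
        using b box by (auto simp: feasible_def)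
      from closed[OF u uw(2,3) this, of "b - f u w"] show False
        using b w uw V by (simp add: net_inflow_push)
    next
      case 2
      \<comment> \<open>The opposite flow on \<open>(w, u)\<close> is cancelled entirely; lowering a
        value never violates a capacity.\<close>
      have le: "ereal (f x y - a) \<le> c x y" if "a \<ge> 0" for a x y
        using that box(2)[of x y] by (elim order_trans[rotated]) simp
      then have "feasible (\<lambda>x y. f x y + (if x = w \<and> y = u then - f w u else 0))"
        using box 2 le[of "f w u" w u] by (auto simp: feasible_def)
      from closed[OF u uw(2,3) this, of "f w u"] show False
        using 2 w uw V by (simp add: net_inflow_push)
    qed
  qed
  with \<open>t \<notin> R\<close> V show thesis
    by (intro that[of R]) (auto simp: R_def)
qed

section \<open>The vertex cover of an integral maximum flow\<close>

locale integral_flow_instance =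
  fixes \<Gamma> :: "('a, 'i) osm_instance" and f :: "('a, 'i) net_flow"
  assumes valid: "valid_instance \<Gamma>" and max_flow: "integral_max_flow \<Gamma> f"
begin

lemma finite_instance: "finite (advertisers \<Gamma>)" "finite (impressions \<Gamma>)"
  using valid by (auto simp: valid_instance_def)

lemma finite_net_vertices: "finite (net_vertices \<Gamma>)"
  using finite_instance by (simp add: net_vertices_def)

lemma finite_flow_advertisers: "finite (flow_advertisers \<Gamma> f)"
  using finite_instance by (simp add: flow_advertisers_def)

lemma flow_nonneg: "0 \<le> f u v" and flow_le_cap: "ereal (f u v) \<le> net_cap \<Gamma> u v"
  using max_flow by (auto simp: integral_max_flow_def is_max_flow_def is_flow_def)

lemma flow_eq_0: "net_cap \<Gamma> u v = 0 \<Longrightarrow> f u v = 0"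
  using flow_nonneg[of u v] flow_le_cap[of u v] by simp

lemma sum_net_vertices:
  fixes g :: "('a, 'i) vertex \<Rightarrow> real"
  shows "sum g (net_vertices \<Gamma>) = g Source + g Sink +
    (\<Sum>a\<in>advertisers \<Gamma>. g (Adv a)) + (\<Sum>i\<in>impressions \<Gamma>. g (Imp i))"
proof -
  have "Adv ` advertisers \<Gamma> \<inter> Imp ` impressions \<Gamma> = {}" by auto
  then show ?thesis
    using finite_instance
    by (simp add: net_vertices_def sum.union_disjoint image_iff sum.reindex inj_on_def)
qed

lemma conservation:
  assumes "v \<in> net_vertices \<Gamma>" "v \<noteq> Source" "v \<noteq> Sink"
  shows "(\<Sum>u\<in>net_vertices \<Gamma>. f u v) = (\<Sum>u\<in>net_vertices \<Gamma>. f v u)"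
  using max_flow assms by (auto simp: integral_max_flow_def is_max_flow_def is_flow_def)

lemma advertiser_outflow:
  assumes "a \<in> advertisers \<Gamma>"
  shows "(\<Sum>i\<in>impressions \<Gamma>. f (Adv a) (Imp i)) = f Source (Adv a)"
  using conservation[of "Adv a"] assms
  by (simp add: sum_net_vertices flow_eq_0) (simp add: net_vertices_def)

lemma impression_inflow:
  assumes "i \<in> impressions \<Gamma>"
  shows "(\<Sum>a\<in>advertisers \<Gamma>. f (Adv a) (Imp i)) = f (Imp i) Sink"
  using conservation[of "Imp i"] assms
  by (simp add: sum_net_vertices flow_eq_0) (simp add: net_vertices_def)

text \<open>The outflow equals the inflow from the source, an integer between 0 and the capacity
  1.\<close>

lemma advertiser_outflow_of_bool:
  assumes "a \<in> advertisers \<Gamma>"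
  shows "(\<Sum>i\<in>impressions \<Gamma>. f (Adv a) (Imp i)) = of_bool (a \<in> flow_advertisers \<Gamma> f)"
proof -
  have "f Source (Adv a) \<in> \<int>"
    using max_flow by (simp add: integral_max_flow_def)
  then obtain k where k: "f Source (Adv a) = of_int k" by (auto elim: Ints_cases)
  have "f Source (Adv a) \<le> 1"
    using flow_le_cap[of Source "Adv a"] assms by (simp add: one_ereal_def)
  then have "k = 0 \<or> k = 1"
    using flow_nonneg[of Source "Adv a"] by (auto simp: k)
  then show ?thesis
    using assms k by (auto simp: advertiser_outflow flow_advertisers_def)
qed

lemma card_flow_advertisers:
  "real (card (flow_advertisers \<Gamma> f)) =
    (\<Sum>a\<in>advertisers \<Gamma>. \<Sum>i\<in>impressions \<Gamma>. f (Adv a) (Imp i))"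
proof -
  have "flow_advertisers \<Gamma> f = {a \<in> advertisers \<Gamma>. a \<in> flow_advertisers \<Gamma> f}"
    by (auto simp: flow_advertisers_def)
  then show ?thesis
    using finite_instance by (simp add: advertiser_outflow_of_bool Int_def cong: conj_cong)
qed

text \<open>\<open>B\<close> consists of the advertisers on the sink side of a saturated cut and
  \<open>T\<close> of the impression types on its source side. The edges from the source to
  \<open>B\<close> and from \<open>T\<close> to the sink are full, and every unit of flow uses
  exactly one of them.\<close>

lemma vertex_cover:
  obtains B T where "B \<subseteq> advertisers \<Gamma>" "T \<subseteq> impressions \<Gamma>"
    "\<And>a i. (a, i) \<in> allowed \<Gamma> \<Longrightarrow> a \<in> B \<or> i \<in> T"
    "card (flow_advertisers \<Gamma> f) = card B + (\<Sum>i\<in>T. expected \<Gamma> i)"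
proof -
  let ?V = "net_vertices \<Gamma>" and ?A = "advertisers \<Gamma>" and ?I = "impressions \<Gamma>"
  have "Source \<in> ?V" "Sink \<in> ?V" by (auto simp: net_vertices_def)
  from max_flow_saturated_cut[OF finite_net_vertices this, of "net_cap \<Gamma>" f] max_flow
  obtain R where R: "R \<subseteq> ?V" "Source \<in> R" "Sink \<notin> R"
    "\<And>u v. u \<in> R \<Longrightarrow> v \<in> ?V - R \<Longrightarrow> ereal (f u v) = net_cap \<Gamma> u v \<and> f v u = 0"
    by (auto simp: integral_max_flow_def)
  define B where "B = {a \<in> ?A. Adv a \<notin> R}"
  define T where "T = {i \<in> ?I. Imp i \<in> R}"
  have B: "f Source (Adv a) = 1" if "a \<in> B" for a
    using R(4)[of Source "Adv a"] R(2) that by (auto simp: B_def net_vertices_def one_ereal_def)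
  have T: "f (Imp i) Sink = expected \<Gamma> i" if "i \<in> T" for i
    using R(4)[of "Imp i" Sink] R(3) that by (auto simp: T_def net_vertices_def)
  \<comment> \<open>An allowed edge has infinite capacity, which a real flow value cannot saturate;
    hence none leads from the source side to the sink side.\<close>
  have AB_T: "f (Adv a) (Imp i) = 0 \<and> (a, i) \<notin> allowed \<Gamma>" if "a \<in> ?A - B" "i \<in> ?I - T" for a i
    using R(4)[of "Adv a" "Imp i"] that
    by (cases "(a, i) \<in> allowed \<Gamma>") (auto simp: B_def T_def net_vertices_def flow_eq_0)
  \<comment> \<open>These edges run backwards across the cut and are therefore empty, so no unit is
    counted both at \<open>B\<close> and at \<open>T\<close>.\<close>
  have B_T: "f (Adv a) (Imp i) = 0" if "a \<in> B" "i \<in> T" for a i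
    using R(4)[of "Imp i" "Adv a"] that by (auto simp: B_def T_def net_vertices_def)
  have sub: "B \<subseteq> ?A" "T \<subseteq> ?I" by (auto simp: B_def T_def)
  have "real (card (flow_advertisers \<Gamma> f)) =
      (\<Sum>a\<in>?A - B. \<Sum>i\<in>?I. f (Adv a) (Imp i)) + (\<Sum>a\<in>B. \<Sum>i\<in>?I. f (Adv a) (Imp i))"
    using finite_instance sub unfolding card_flow_advertisers by (intro sum.subset_diff) auto
  also have "(\<Sum>a\<in>B. \<Sum>i\<in>?I. f (Adv a) (Imp i)) = (\<Sum>a\<in>B. 1)"
    using sub B by (intro sum.cong refl) (auto simp: advertiser_outflow)
  also have "(\<Sum>a\<in>?A - B. \<Sum>i\<in>?I. f (Adv a) (Imp i)) = (\<Sum>a\<in>?A - B. \<Sum>i\<in>T. f (Adv a) (Imp i))"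
    using finite_instance sub AB_T by (intro sum.cong refl sum.mono_neutral_right) auto
  also have "\<dots> = (\<Sum>i\<in>T. \<Sum>a\<in>?A - B. f (Adv a) (Imp i))"
    by (rule sum.swap)
  also have "\<dots> = (\<Sum>i\<in>T. \<Sum>a\<in>?A. f (Adv a) (Imp i))"
    using finite_instance sub B_T by (intro sum.cong refl sum.mono_neutral_left) auto
  also have "\<dots> = (\<Sum>i\<in>T. real (expected \<Gamma> i))"
    using sub T by (intro sum.cong refl) (auto simp: impression_inflow)
  finally have "real (card (flow_advertisers \<Gamma> f)) = real (card B + (\<Sum>i\<in>T. expected \<Gamma> i))"
    by simp
  moreover have "a \<in> B \<or> i \<in> T" if "(a, i) \<in> allowed \<Gamma>" for a i
    using AB_T[of a i] that valid by (auto simp: valid_instance_def)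
  ultimately show thesis
    using sub that by (simp only: of_nat_eq_iff)
qed

end

section \<open>Covers bound the matchings of every realization\<close>

text \<open>The \<open>Max\<close> in \<open>OPT\<close> is over a finite set of sizes, made
  nonempty by the empty matching, so it is attained.\<close>

lemma OPT_attained:
  assumes "valid_instance \<Gamma>"
  obtains M where "bipartite_matching (realization_edges \<Gamma> js) M" "OPT \<Gamma> js = card M"
    "\<And>M'. bipartite_matching (realization_edges \<Gamma> js) M' \<Longrightarrow> card M' \<le> card M"
proof -
  let ?E = "realization_edges \<Gamma> js"
  have "?E \<subseteq> advertisers \<Gamma> \<times> {..<length js}"
    using assms by (auto simp: realization_edges_def valid_instance_def)
  then have "finite ?E"
    using assms by (elim finite_subset) (auto simp: valid_instance_def)
  then have "finite {M. bipartite_matching ?E M}"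
    by (auto simp: bipartite_matching_def intro: finite_subset[of _ "Pow ?E"])
  then have fin: "finite {card M | M. bipartite_matching ?E M}"
    by (simp add: setcompr_eq_image)
  moreover have "card {} \<in> {card M | M. bipartite_matching ?E M}"
    by (auto simp: bipartite_matching_def intro!: exI[of _ "{}"])
  ultimately have "OPT \<Gamma> js \<in> {card M | M. bipartite_matching ?E M}"
    unfolding OPT_def by (intro Max_in) auto
  then obtain M where M: "bipartite_matching ?E M" "OPT \<Gamma> js = card M" by auto
  have "card M' \<le> OPT \<Gamma> js" if "bipartite_matching ?E M'" for M'
    unfolding OPT_def using fin that by (intro Max_ge) auto
  with M show thesis by (intro that[of M]) auto
qed

text \<open>Edges of a matching with advertiser in \<open>B\<close> inject into \<open>B\<close>.
  Each remaining edge has its type in \<open>T\<close>, and these inject into the positions of such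
  draws.\<close>

lemma OPT_le_cover:
  assumes "valid_instance \<Gamma>" "B \<subseteq> advertisers \<Gamma>"
    and cover: "\<And>a i. (a, i) \<in> allowed \<Gamma> \<Longrightarrow> a \<in> B \<or> i \<in> T"
  shows "OPT \<Gamma> js \<le> card B + length (filter (\<lambda>i. i \<in> T) js)"
proof -
  obtain M where M: "bipartite_matching (realization_edges \<Gamma> js) M" "OPT \<Gamma> js = card M"
    using OPT_attained[OF assms(1)] by metis
  let ?J = "{j. j < length js \<and> js ! j \<in> T}"
  define M1 where "M1 = {e \<in> M. fst e \<in> B}"
  define M2 where "M2 = {e \<in> M. fst e \<notin> B}"
  have edge: "snd e < length js \<and> (fst e, js ! snd e) \<in> allowed \<Gamma>" if "e \<in> M" for e
    using M(1) that by (auto simp: bipartite_matching_def realization_edges_def)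
  have inj: "inj_on fst M1" "inj_on snd M2"
    using M by (auto simp: bipartite_matching_def M1_def M2_def inj_on_def)
  have "finite B" using finite_subset[OF assms(2)] assms(1) by (auto simp: valid_instance_def)
  have "card M1 \<le> card B"
    using inj(1) by (rule card_inj_on_le) (use \<open>finite B\<close> in \<open>auto simp: M1_def\<close>)
  moreover have "card M2 \<le> card ?J"
    using inj(2) by (rule card_inj_on_le)
      (use edge cover in \<open>fastforce simp: M2_def\<close>)+
  moreover have "card M \<le> card M1 + card M2"
    using card_Un_le[of M1 M2] by (simp add: M1_def M2_def flip: Collect_disj_eq)
      (metis (mono_tags, lifting) Collect_cong Collect_mem_eq)
  ultimately show ?thesis
    using M(2) by (simp add: length_filter_conv_card)
qed

section \<open>Independent choices\<close>

lemma prob_eq_expectation_indicator: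
  "measure_pmf.prob p X = measure_pmf.expectation p (indicator X)"
  by simp

lemma prob_replicate_pmf_avoid:
  assumes "finite (set_pmf p)"
  shows "measure_pmf.prob (replicate_pmf n p) {zs. set zs \<inter> Z = {}} = (1 - measure_pmf.prob p Z) ^ n"
proof (induction n)
  case 0
  then show ?case by (simp add: indicator_def)
next
  case (Suc n)
  let ?avoid = "{zs. set zs \<inter> Z = {}}"
  have "indicator ?avoid (z # zs) = (indicator (- Z) z * indicator ?avoid zs :: real)" for z zs
    by (auto simp: indicator_def)
  then show ?case
    unfolding prob_eq_expectation_indicator expectation_replicate_pmf_Suc[OF assms]
    using Suc measure_pmf.prob_compl[of Z p] by (simp add: Compl_eq_Diff_UNIV)
qed

lemma expectation_length_filter_replicate_pmf:
  assumes "finite (set_pmf p)"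
  shows "measure_pmf.expectation (replicate_pmf n p) (\<lambda>zs. real (length (filter (\<lambda>z. z \<in> Z) zs))) =
    real n * measure_pmf.prob p Z"
proof (induction n)
  case 0
  then show ?case by simp
next
  case (Suc n)
  have int: "integrable (measure_pmf (replicate_pmf n p)) k" for k :: "'a list \<Rightarrow> real"
    using assms by (intro integrable_measure_pmf_finite finite_set_replicate_pmf)
  have int': "integrable (measure_pmf p) k" for k :: "'a \<Rightarrow> real"
    using assms by (rule integrable_measure_pmf_finite)
  have "real (length (filter (\<lambda>z. z \<in> Z) (z # zs))) =
      indicator Z z + real (length (filter (\<lambda>z. z \<in> Z) zs))" for z zs
    by (simp add: indicator_def)
  then show ?case
    unfolding expectation_replicate_pmf_Suc[OF assms]
    using Suc by (simp add: int int' algebra_simps del: filter.simps)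
qed

section \<open>Separating the random choices from the assignment bookkeeping\<close>

text \<open>The deterministic part of the online rule, applied to a list of choices that have
  already been sampled.\<close>

primrec first_choices :: "'a set \<Rightarrow> 'a option list \<Rightarrow> 'a option list" where
  "first_choices U [] = []"
| "first_choices U (x # xs) =
     (let y = (case x of None \<Rightarrow> None | Some a \<Rightarrow> if a \<in> U then None else Some a)
      in y # first_choices (U \<union> set_option y) xs)"

text \<open>An advertiser outside \<open>U\<close> is assigned exactly at its first occurrence.
  General \<open>U\<close> is needed because the recursion enlarges it.\<close>

lemma ALG_first_choices: "ALG (first_choices U xs) = card ({a. Some a \<in> set xs} - U)"
proof (induction xs arbitrary: U)
  case Nil
  then show ?case by (simp add: ALG_def)
next
  case (Cons x xs)
  have fin: "finite {a. Some a \<in> set ys}" for ys :: "'a option list"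
    using finite_vimageI[of "set ys" Some] by (simp add: vimage_def)
  show ?case
  proof (cases "\<exists>a. x = Some a \<and> a \<notin> U")
    case True
    then obtain a where a: "x = Some a" "a \<notin> U" by auto
    have "{b. Some b \<in> set (x # xs)} - U = insert a ({b. Some b \<in> set xs} - (U \<union> {a}))"
      using a by auto
    then show ?thesis
      using Cons.IH[of "U \<union> {a}"] a fin by (simp add: ALG_def)
  next
    case False
    then have "{b. Some b \<in> set (x # xs)} - U = {b. Some b \<in> set xs} - U"
      by auto
    moreover have "ALG (first_choices U (x # xs)) = ALG (first_choices U xs)"
      using False by (cases x) (auto simp: ALG_def)
    ultimately show ?thesis
      using Cons.IH by simp
  qed
qed

definition step_pmf :: "('a, 'i) osm_instance \<Rightarrow> ('a, 'i) net_flow \<Rightarrow> ('i \<times> 'a option) pmf" where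
  "step_pmf \<Gamma> f = bind_pmf (draw_pmf \<Gamma>) (\<lambda>i. map_pmf (Pair i) (choice_pmf \<Gamma> f i))"

text \<open>The choice made for a type ignores \<open>U\<close>, so all pairs of draw and choice can
  be sampled independently first and filtered afterwards.\<close>

lemma bind_replicate_pmf_suggested_matching:
  "bind_pmf (replicate_pmf n (draw_pmf \<Gamma>)) (\<lambda>js. map_pmf (Pair js) (suggested_matching \<Gamma> f U js)) =
     map_pmf (\<lambda>zs. (map fst zs, first_choices U (map snd zs))) (replicate_pmf n (step_pmf \<Gamma> f))"
proof (induction n arbitrary: U)
  case 0
  then show ?case by (simp add: bind_return_pmf)
next
  case (Suc n)
  let ?y = "\<lambda>x. case x of None \<Rightarrow> None | Some a \<Rightarrow> if a \<in> U then None else Some a"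
  let ?U = "\<lambda>x. U \<union> set_option (?y x)"
  have "bind_pmf (replicate_pmf (Suc n) (draw_pmf \<Gamma>))
        (\<lambda>js. map_pmf (Pair js) (suggested_matching \<Gamma> f U js)) =
      bind_pmf (draw_pmf \<Gamma>) (\<lambda>i. bind_pmf (replicate_pmf n (draw_pmf \<Gamma>)) (\<lambda>js.
        bind_pmf (choice_pmf \<Gamma> f i) (\<lambda>x.
          map_pmf (\<lambda>ys. (i # js, ?y x # ys)) (suggested_matching \<Gamma> f (?U x) js))))"
    by (simp add: bind_assoc_pmf bind_return_pmf map_bind_pmf map_pmf_comp Let_def)
  also have "\<dots> = bind_pmf (draw_pmf \<Gamma>) (\<lambda>i. bind_pmf (choice_pmf \<Gamma> f i) (\<lambda>x.
        bind_pmf (replicate_pmf n (draw_pmf \<Gamma>)) (\<lambda>js.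
          map_pmf (\<lambda>ys. (i # js, ?y x # ys)) (suggested_matching \<Gamma> f (?U x) js))))"
    \<comment> \<open>The current choice and the remaining draws are independent. With the choice
      outermost, the induction hypothesis applies for the enlarged set.\<close>
    by (subst bind_commute_pmf) (rule refl)
  also have "\<dots> = bind_pmf (draw_pmf \<Gamma>) (\<lambda>i. bind_pmf (choice_pmf \<Gamma> f i) (\<lambda>x.
        map_pmf (\<lambda>(js, ys). (i # js, ?y x # ys)) (bind_pmf (replicate_pmf n (draw_pmf \<Gamma>)) (\<lambda>js.
          map_pmf (Pair js) (suggested_matching \<Gamma> f (?U x) js)))))"
    by (simp add: map_bind_pmf map_pmf_comp)
  also have "\<dots> = map_pmf (\<lambda>zs. (map fst zs, first_choices U (map snd zs)))
      (replicate_pmf (Suc n) (step_pmf \<Gamma> f))"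
    unfolding Suc.IH
    by (simp add: step_pmf_def map_bind_pmf map_pmf_comp bind_assoc_pmf bind_map_pmf Let_def
        flip: map_pmf_def)
  finally show ?case .
qed

lemma suggested_outcome_pmf_eq:
  "suggested_outcome_pmf \<Gamma> f =
     map_pmf (\<lambda>zs. (map fst zs, first_choices {} (map snd zs)))
       (replicate_pmf (num_draws \<Gamma>) (step_pmf \<Gamma> f))"
  unfolding outcome_pmf_def by (rule bind_replicate_pmf_suggested_matching)

definition chosen :: "('i \<times> 'a option) list \<Rightarrow> 'a set" where
  "chosen zs = {a. Some a \<in> snd ` set zs}"

lemma ALG_first_choices_empty: "ALG (first_choices {} (map snd zs)) = card (chosen zs)"
  by (simp add: ALG_first_choices chosen_def)

lemma finite_chosen: "finite (chosen zs)"
  using finite_vimageI[of "snd ` set zs" Some] by (simp add: chosen_def vimage_def)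

text \<open>Only the advertiser of \<open>z\<close>, if any, can be chosen in the first list but not
  in the second.\<close>

lemma card_chosen_bounded_differences:
  "real (card (chosen (xs @ z # ys))) - real (card (chosen (xs @ z' # ys))) \<le> 1"
proof -
  have "card (chosen (xs @ z # ys)) \<le> card (set_option (snd z) \<union> chosen (xs @ z' # ys))"
    by (intro card_mono) (auto simp: finite_chosen, auto simp: chosen_def)
  also have "\<dots> \<le> card (set_option (snd z)) + card (chosen (xs @ z' # ys))"
    by (rule card_Un_le)
  also have "card (set_option (snd z)) \<le> 1" by (cases "snd z") auto
  finally show ?thesis by simp
qed

lemma one_minus_power_le_exp: "n > 0 \<Longrightarrow> (1 - 1 / real n) ^ n \<le> 1 / exp 1"
  using exp_ge_one_minus_x_over_n_power_n[of 1 n] by (simp add: exp_minus inverse_eq_divide)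

section \<open>Concentration of ALG and OPT\<close>

context integral_flow_instance
begin

lemma set_draw_pmf: "set_pmf (draw_pmf \<Gamma>) \<subseteq> impressions \<Gamma>"
  by (auto simp: set_pmf_iff pmf_draw_pmf[OF valid] split: if_splits)

lemma set_choice_pmf:
  assumes "i \<in> impressions \<Gamma>"
  shows "set_pmf (choice_pmf \<Gamma> f i) \<subseteq> insert None (Some ` advertisers \<Gamma>)"
  by (auto simp: set_pmf_iff pmf_choice_pmf[OF valid max_flow assms] split: option.splits if_splits)

text \<open>Supplies the finiteness hypothesis of the concentration bounds and with it integrability
  of every function of the steps.\<close>

lemma finite_set_step_pmf: "finite (set_pmf (step_pmf \<Gamma> f))"
proof -
  have "finite (set_pmf (choice_pmf \<Gamma> f i))" if "i \<in> set_pmf (draw_pmf \<Gamma>)" for i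
    using set_choice_pmf[of i] set_draw_pmf that finite_instance
    by (meson finite_imageI finite_insert finite_subset subsetD)
  then show ?thesis
    using finite_subset[OF set_draw_pmf] finite_instance by (simp add: step_pmf_def)
qed

lemma map_fst_step_pmf: "map_pmf fst (step_pmf \<Gamma> f) = draw_pmf \<Gamma>"
  by (simp add: step_pmf_def map_bind_pmf map_pmf_comp map_pmf_const bind_return_pmf')

lemma prob_step_impression:
  assumes "T \<subseteq> impressions \<Gamma>"
  shows "measure_pmf.prob (step_pmf \<Gamma> f) {z. fst z \<in> T} =
    real (\<Sum>i\<in>T. expected \<Gamma> i) / real (num_draws \<Gamma>)"
proof -
  have "finite T" using finite_subset[OF assms] finite_instance by simp
  have "measure_pmf.prob (step_pmf \<Gamma> f) {z. fst z \<in> T} = measure_pmf.prob (draw_pmf \<Gamma>) T"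
    by (subst map_fst_step_pmf[symmetric]) (simp add: vimage_def)
  also have "\<dots> = (\<Sum>i\<in>T. pmf (draw_pmf \<Gamma>) i)"
    using \<open>finite T\<close> by (rule measure_measure_pmf_finite)
  also have "\<dots> = (\<Sum>i\<in>T. real (expected \<Gamma> i) / real (num_draws \<Gamma>))"
    using assms by (intro sum.cong refl) (auto simp: pmf_draw_pmf[OF valid])
  finally show ?thesis by (simp add: sum_divide_distrib)
qed

text \<open>The factor \<open>expected \<Gamma> i\<close> cancels between the probability of drawing
  \<open>i\<close> and that of then choosing \<open>a\<close>; what remains is the outflow of
  \<open>a\<close>, divided by the number of draws.\<close>

lemma prob_step_advertiser:
  "measure_pmf.prob (step_pmf \<Gamma> f) {z. snd z = Some a} =
    of_bool (a \<in> flow_advertisers \<Gamma> f) / real (num_draws \<Gamma>)"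
proof -
  have "measure_pmf.prob (step_pmf \<Gamma> f) {z. snd z = Some a} =
      pmf (bind_pmf (draw_pmf \<Gamma>) (choice_pmf \<Gamma> f)) (Some a)"
  proof -
    have "map_pmf snd (step_pmf \<Gamma> f) = bind_pmf (draw_pmf \<Gamma>) (choice_pmf \<Gamma> f)"
      by (simp add: step_pmf_def map_bind_pmf map_pmf_comp)
    moreover have "measure_pmf.prob (step_pmf \<Gamma> f) {z. snd z = Some a} =
        pmf (map_pmf snd (step_pmf \<Gamma> f)) (Some a)"
      by (simp add: pmf_map vimage_def)
    ultimately show ?thesis by simp
  qed
  also have "\<dots> = (\<Sum>i\<in>impressions \<Gamma>. pmf (choice_pmf \<Gamma> f i) (Some a) * pmf (draw_pmf \<Gamma>) i)"
    unfolding pmf_bind using finite_instance(2)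
    by (rule integral_measure_pmf_real) (use set_draw_pmf in auto)
  also have "\<dots> = (\<Sum>i\<in>impressions \<Gamma>.
      (if a \<in> advertisers \<Gamma> then f (Adv a) (Imp i) else 0) / real (num_draws \<Gamma>))"
    using valid by (intro sum.cong refl)
      (auto simp: pmf_draw_pmf[OF valid] pmf_choice_pmf[OF valid max_flow] valid_instance_def)
  also have "\<dots> = of_bool (a \<in> flow_advertisers \<Gamma> f) / real (num_draws \<Gamma>)"
  proof (cases "a \<in> advertisers \<Gamma>")
    case True
    then show ?thesis
      by (simp add: advertiser_outflow_of_bool flip: sum_divide_distrib)
  qed (simp add: flow_advertisers_def)
  finally show ?thesis .
qed

abbreviation steps_pmf :: "('i \<times> 'a option) list pmf" where
  "steps_pmf \<equiv> replicate_pmf (num_draws \<Gamma>) (step_pmf \<Gamma> f)"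

text \<open>Linearity of expectation over the advertisers carrying flow: each is missed in all
  independent steps with probability \<open>(1 - 1 / n) ^ n\<close>.\<close>

lemma expectation_card_chosen:
  "measure_pmf.expectation steps_pmf (\<lambda>zs. real (card (chosen zs))) =
    real (card (flow_advertisers \<Gamma> f)) * (1 - (1 - 1 / real (num_draws \<Gamma>)) ^ num_draws \<Gamma>)"
proof -
  let ?n = "num_draws \<Gamma>" and ?S = "flow_advertisers \<Gamma> f"
  \<comment> \<open>This holds only on the support: other advertisers are chosen with probability
    0.\<close>
  have "chosen zs \<subseteq> ?S" if "zs \<in> set_pmf steps_pmf" for zs
  proof
    fix a assume "a \<in> chosen zs"
    then obtain z where "z \<in> set zs" "snd z = Some a"
      by (force simp: chosen_def)
    moreover have "set zs \<subseteq> set_pmf (step_pmf \<Gamma> f)"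
      using that by (auto simp: set_replicate_pmf)
    ultimately have z: "z \<in> set_pmf (step_pmf \<Gamma> f)" "snd z = Some a" by auto
    then have "measure_pmf.prob (step_pmf \<Gamma> f) {z. snd z = Some a} > 0"
      by (intro measure_pmf_posI) auto
    then show "a \<in> ?S"
      by (simp add: prob_step_advertiser of_bool_def split: if_splits)
  qed
  then have "real (card (chosen zs)) = (\<Sum>a\<in>?S. indicator {zs. a \<in> chosen zs} zs)"
    if "zs \<in> set_pmf steps_pmf" for zs
    using that finite_flow_advertisers by (auto simp: indicator_def Int_absorb1)
  then have "measure_pmf.expectation steps_pmf (\<lambda>zs. real (card (chosen zs))) =
      measure_pmf.expectation steps_pmf (\<lambda>zs. \<Sum>a\<in>?S. indicator {zs. a \<in> chosen zs} zs)"
    by (intro integral_cong_AE) (auto simp: AE_measure_pmf_iff)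
  also have "\<dots> = (\<Sum>a\<in>?S. measure_pmf.prob steps_pmf {zs. a \<in> chosen zs})"
    unfolding prob_eq_expectation_indicator
    by (intro Bochner_Integration.integral_sum integrable_measure_pmf_finite
        finite_set_replicate_pmf finite_set_step_pmf)
  also have "\<dots> = (\<Sum>a\<in>?S. 1 - (1 - 1 / real ?n) ^ ?n)"
  proof (rule sum.cong[OF refl])
    fix a assume a: "a \<in> ?S"
    have "{zs :: ('i \<times> 'a option) list. a \<in> chosen zs} = - {zs. set zs \<inter> {z. snd z = Some a} = {}}"
      by (force simp: chosen_def)
    then have "measure_pmf.prob steps_pmf {zs. a \<in> chosen zs} =
        1 - measure_pmf.prob steps_pmf {zs. set zs \<inter> {z. snd z = Some a} = {}}"
      using measure_pmf.prob_compl[of "{zs. set zs \<inter> {z. snd z = Some a} = {}}" steps_pmf]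
      by (simp add: Compl_eq_Diff_UNIV)
    then show "measure_pmf.prob steps_pmf {zs. a \<in> chosen zs} = 1 - (1 - 1 / real ?n) ^ ?n"
      using a by (simp add: prob_replicate_pmf_avoid finite_set_step_pmf prob_step_advertiser)
  qed
  finally show ?thesis by simp
qed

text \<open>Union bound over two bad events, a low number of chosen advertisers and a high number of
  draws in \<open>T\<close>. \<open>OPT\<close> itself need not be concentrated, being dominated
  pointwise by the cover.\<close>

lemma ALG_OPT_whp:
  assumes "\<epsilon> > 0"
  shows "measure_pmf.prob (suggested_outcome_pmf \<Gamma> f)
      {(js, ys).
         real (ALG ys) \<ge> (1 - 1 / exp 1) * real (card (flow_advertisers \<Gamma> f))
                           - \<epsilon> * real (num_draws \<Gamma>) \<and>
         real (OPT \<Gamma> js) \<le> real (card (flow_advertisers \<Gamma> f)) + \<epsilon> * real (num_draws \<Gamma>)}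
    \<ge> 1 - 2 * exp (- 2 * \<epsilon>\<^sup>2 * real (num_draws \<Gamma>))" (is "measure_pmf.prob _ ?good \<ge> _")
proof -
  let ?n = "num_draws \<Gamma>" and ?S = "flow_advertisers \<Gamma> f"
  \<comment> \<open>The cover depends on the flow alone and is fixed before the draws, so the count
    of draws in \<open>T\<close> is a sum of independent indicators.\<close>
  obtain B T where BT: "B \<subseteq> advertisers \<Gamma>" "T \<subseteq> impressions \<Gamma>"
    "\<And>a i. (a, i) \<in> allowed \<Gamma> \<Longrightarrow> a \<in> B \<or> i \<in> T"
    "card ?S = card B + (\<Sum>i\<in>T. expected \<Gamma> i)"
    by (rule vertex_cover) (rule that; blast)
  define g1 where "g1 zs = real (card (chosen zs))" for zs :: "('i \<times> 'a option) list"
  define g2 where "g2 zs = real (length (filter (\<lambda>z. z \<in> {z. fst z \<in> T}) zs))"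
    for zs :: "('i \<times> 'a option) list"
  let ?E = "measure_pmf.expectation steps_pmf"
  let ?bad1 = "{zs. g1 zs \<le> ?E g1 - \<epsilon> * real ?n}" and ?bad2 = "{zs. g2 zs \<ge> ?E g2 + \<epsilon> * real ?n}"
  let ?h = "\<lambda>zs. (map fst zs, first_choices {} (map snd zs))"
  have "?n > 0" using num_draws_pos[OF valid] .
  have E1: "?E g1 \<ge> (1 - 1 / exp 1) * real (card ?S)"
    using one_minus_power_le_exp[OF \<open>?n > 0\<close>] unfolding g1_def expectation_card_chosen
    by (subst mult.commute) (intro mult_left_mono, auto)
  have E2: "?E g2 = real (\<Sum>i\<in>T. expected \<Gamma> i)"
    using \<open>?n > 0\<close> unfolding g2_def
    by (subst expectation_length_filter_replicate_pmf[OF finite_set_step_pmf])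
      (simp add: prob_step_impression[OF BT(2)])
  have OPT_le: "real (OPT \<Gamma> (map fst zs)) \<le> real (card B) + g2 zs" for zs
    using OPT_le_cover[OF valid BT(1,3), of "map fst zs"]
    by (simp add: g2_def filter_map o_def)
  have "?h zs \<in> ?good" if "zs \<notin> ?bad1" "zs \<notin> ?bad2" for zs
    using that E1 E2 OPT_le[of zs] BT(4)
    by (simp add: ALG_first_choices_empty g1_def)
  then have "- (?h -` ?good) \<subseteq> ?bad1 \<union> ?bad2" by blast
  then have "measure_pmf.prob steps_pmf (- (?h -` ?good)) \<le> measure_pmf.prob steps_pmf (?bad1 \<union> ?bad2)"
    by (intro measure_pmf.finite_measure_mono) auto
  also have "\<dots> \<le> measure_pmf.prob steps_pmf ?bad1 + measure_pmf.prob steps_pmf ?bad2"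
    by (intro measure_Un_le) auto
  also have "\<dots> \<le> exp (- 2 * \<epsilon>\<^sup>2 * ?n) + exp (- 2 * \<epsilon>\<^sup>2 * ?n)"
    using assms
    by (intro add_mono McDiarmid_lower McDiarmid_upper finite_set_step_pmf)
      (auto simp: g1_def g2_def card_chosen_bounded_differences)
  finally show ?thesis
    using measure_pmf.prob_compl[of "?h -` ?good" steps_pmf]
    unfolding suggested_outcome_pmf_eq measure_map_pmf by (simp add: Compl_eq_Diff_UNIV)
qed

lemma expectation_ALG:
  "measure_pmf.expectation (suggested_outcome_pmf \<Gamma> f) (\<lambda>(js, ys). real (ALG ys)) =
    real (card (flow_advertisers \<Gamma> f)) * (1 - (1 - 1 / real (num_draws \<Gamma>)) ^ num_draws \<Gamma>)"
  unfolding suggested_outcome_pmf_eq expectation_card_chosen[symmetric]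
  by (simp add: ALG_first_choices_empty)

text \<open>Two-sided and around the exact mean, because tightness also requires an upper bound on
  \<open>ALG\<close>.\<close>

lemma ALG_concentrated:
  assumes "\<epsilon> > 0"
  shows "measure_pmf.prob (suggested_outcome_pmf \<Gamma> f)
      {(js, ys). \<bar>real (ALG ys) - real (card (flow_advertisers \<Gamma> f)) *
          (1 - (1 - 1 / real (num_draws \<Gamma>)) ^ num_draws \<Gamma>)\<bar> \<le> \<epsilon> * real (num_draws \<Gamma>)}
    \<ge> 1 - 2 * exp (- 2 * \<epsilon>\<^sup>2 * real (num_draws \<Gamma>))" (is "measure_pmf.prob _ ?good \<ge> _")
proof -
  let ?n = "num_draws \<Gamma>"
  define g where "g zs = real (card (chosen zs))" for zs :: "('i \<times> 'a option) list"
  let ?E = "measure_pmf.expectation steps_pmf"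
  let ?bad1 = "{zs. g zs \<le> ?E g - \<epsilon> * real ?n}" and ?bad2 = "{zs. g zs \<ge> ?E g + \<epsilon> * real ?n}"
  let ?h = "\<lambda>zs. (map fst zs, first_choices {} (map snd zs))"
  have "?h zs \<in> ?good" if "zs \<notin> ?bad1" "zs \<notin> ?bad2" for zs
    using that unfolding g_def expectation_card_chosen by (simp add: ALG_first_choices_empty)
  then have "- (?h -` ?good) \<subseteq> ?bad1 \<union> ?bad2" by blast
  then have "measure_pmf.prob steps_pmf (- (?h -` ?good)) \<le> measure_pmf.prob steps_pmf (?bad1 \<union> ?bad2)"
    by (intro measure_pmf.finite_measure_mono) auto
  also have "\<dots> \<le> measure_pmf.prob steps_pmf ?bad1 + measure_pmf.prob steps_pmf ?bad2"
    by (intro measure_Un_le) auto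
  also have "\<dots> \<le> exp (- 2 * \<epsilon>\<^sup>2 * ?n) + exp (- 2 * \<epsilon>\<^sup>2 * ?n)"
    using assms
    by (intro add_mono McDiarmid_lower McDiarmid_upper finite_set_step_pmf)
      (auto simp: g_def card_chosen_bounded_differences)
  finally show ?thesis
    using measure_pmf.prob_compl[of "?h -` ?good" steps_pmf]
    unfolding suggested_outcome_pmf_eq measure_map_pmf by (simp add: Compl_eq_Diff_UNIV)
qed

end

section \<open>Constants that do not depend on the instance\<close>

text \<open>Halving the rate absorbs the factor 2 of the union bound as soon as
  \<open>\<epsilon>\<^sup>2 * n \<ge> 1\<close>.\<close>

lemma two_exp_le:
  fixes \<epsilon> :: real
  assumes "real n \<ge> 1 / \<epsilon>\<^sup>2" "\<epsilon> > 0"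
  shows "2 * exp (- 2 * \<epsilon>\<^sup>2 * real n) \<le> exp (- \<epsilon>\<^sup>2 * real n)"
proof -
  have "2 \<le> exp (1::real)" using exp_ge_add_one_self[of 1] by simp
  also have "\<dots> \<le> exp (\<epsilon>\<^sup>2 * real n)" using assms by (simp add: field_simps)
  finally have "2 * exp (- 2 * \<epsilon>\<^sup>2 * real n) \<le> exp (\<epsilon>\<^sup>2 * real n) * exp (- 2 * \<epsilon>\<^sup>2 * real n)"
    by simp
  also have "\<dots> = exp (- \<epsilon>\<^sup>2 * real n)" by (simp flip: exp_add)
  finally show ?thesis .
qed

lemma ALG_OPT_whp_uniform:
  assumes "\<epsilon> > 0"
  shows "\<exists>c>0. \<exists>N. \<forall>(\<Gamma> :: ('a, 'i) osm_instance) f.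
     valid_instance \<Gamma> \<and> integral_max_flow \<Gamma> f \<and> num_draws \<Gamma> \<ge> N \<longrightarrow>
     measure_pmf.prob (suggested_outcome_pmf \<Gamma> f)
       {(js, ys).
          real (ALG ys) \<ge> (1 - 1 / exp 1) * real (card (flow_advertisers \<Gamma> f))
                            - \<epsilon> * real (num_draws \<Gamma>) \<and>
          real (OPT \<Gamma> js) \<le> real (card (flow_advertisers \<Gamma> f)) + \<epsilon> * real (num_draws \<Gamma>)}
     \<ge> 1 - exp (- c * real (num_draws \<Gamma>))"
proof (intro exI[of _ "\<epsilon>\<^sup>2"] conjI exI[of _ "nat \<lceil>1 / \<epsilon>\<^sup>2\<rceil>"] allI impI)
  fix \<Gamma> :: "('a, 'i) osm_instance" and f
  assume *: "valid_instance \<Gamma> \<and> integral_max_flow \<Gamma> f \<and> num_draws \<Gamma> \<ge> nat \<lceil>1 / \<epsilon>\<^sup>2\<rceil>"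
  then interpret integral_flow_instance \<Gamma> f by unfold_locales auto
  have "2 * exp (- 2 * \<epsilon>\<^sup>2 * real (num_draws \<Gamma>)) \<le> exp (- \<epsilon>\<^sup>2 * real (num_draws \<Gamma>))"
    using * assms by (intro two_exp_le) linarith+
  with ALG_OPT_whp[OF assms] show "measure_pmf.prob (suggested_outcome_pmf \<Gamma> f)
       {(js, ys).
          real (ALG ys) \<ge> (1 - 1 / exp 1) * real (card (flow_advertisers \<Gamma> f))
                            - \<epsilon> * real (num_draws \<Gamma>) \<and>
          real (OPT \<Gamma> js) \<le> real (card (flow_advertisers \<Gamma> f)) + \<epsilon> * real (num_draws \<Gamma>)}
     \<ge> 1 - exp (- \<epsilon>\<^sup>2 * real (num_draws \<Gamma>))"
    by linarith
qed (use assms in auto)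

lemma suggested_matching_achieves_factor:
  assumes F: "\<And>\<Gamma> :: ('a, 'i) osm_instance. valid_instance \<Gamma> \<Longrightarrow> integral_max_flow \<Gamma> (F \<Gamma>)"
  shows "achieves_factor_whp (\<lambda>\<Gamma>. suggested_matching \<Gamma> (F \<Gamma>) {}) (1 - 1 / exp 1)"
  unfolding achieves_factor_whp_def
proof (intro allI impI)
  fix \<epsilon> :: real
  assume \<epsilon>: "\<epsilon> > 0"
  define \<alpha> :: real where "\<alpha> = 1 - 1 / exp 1"
  have \<alpha>: "0 \<le> \<alpha>" "\<alpha> \<le> 1" by (auto simp: \<alpha>_def)
  \<comment> \<open>Each of the two estimates gets half of the error. The error of
    \<open>OPT\<close> is multiplied by \<alpha>, which is at most 1, so the total stays within
    \<epsilon> times \<open>n\<close>.\<close>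
  have arith: "x \<ge> \<alpha> * y - \<epsilon> * n" if "x \<ge> \<alpha> * k - \<epsilon> / 2 * n" "y \<le> k + \<epsilon> / 2 * n" "n \<ge> 0" for x y k n
  proof -
    have "\<alpha> * y \<le> \<alpha> * k + \<alpha> * (\<epsilon> / 2 * n)"
      using mult_left_mono[OF that(2) \<alpha>(1)] by (simp add: algebra_simps)
    also have "\<alpha> * (\<epsilon> / 2 * n) \<le> 1 * (\<epsilon> / 2 * n)"
      using \<alpha> \<epsilon> that by (intro mult_right_mono) auto
    finally show ?thesis using that(1) by simp
  qed
  obtain c N where c: "c > 0" and *: "\<And>(\<Gamma> :: ('a, 'i) osm_instance) f.
      valid_instance \<Gamma> \<and> integral_max_flow \<Gamma> f \<and> num_draws \<Gamma> \<ge> N \<Longrightarrow>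
      measure_pmf.prob (suggested_outcome_pmf \<Gamma> f)
       {(js, ys).
          real (ALG ys) \<ge> \<alpha> * real (card (flow_advertisers \<Gamma> f))
                            - \<epsilon> / 2 * real (num_draws \<Gamma>) \<and>
          real (OPT \<Gamma> js) \<le> real (card (flow_advertisers \<Gamma> f)) + \<epsilon> / 2 * real (num_draws \<Gamma>)}
      \<ge> 1 - exp (- c * real (num_draws \<Gamma>))"
    using ALG_OPT_whp_uniform[of "\<epsilon> / 2", where ?'a = 'a and ?'i = 'i] \<epsilon> unfolding \<alpha>_def by auto
  show "\<exists>c>0. \<exists>N. \<forall>\<Gamma>. valid_instance \<Gamma> \<and> num_draws \<Gamma> \<ge> N \<longrightarrow>
        measure_pmf.prob (outcome_pmf \<Gamma> (suggested_matching \<Gamma> (F \<Gamma>) {}))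
          {(js, ys). real (ALG ys) \<ge> (1 - 1 / exp 1) * real (OPT \<Gamma> js) - \<epsilon> * real (num_draws \<Gamma>)}
        \<ge> 1 - exp (- c * real (num_draws \<Gamma>))"
    unfolding \<alpha>_def[symmetric]
  proof (intro exI[of _ c] conjI exI[of _ N] allI impI c)
    fix \<Gamma> :: "('a, 'i) osm_instance"
    assume \<Gamma>: "valid_instance \<Gamma> \<and> num_draws \<Gamma> \<ge> N"
    show "measure_pmf.prob (suggested_outcome_pmf \<Gamma> (F \<Gamma>))
        {(js, ys). real (ALG ys) \<ge> \<alpha> * real (OPT \<Gamma> js) - \<epsilon> * real (num_draws \<Gamma>)}
      \<ge> 1 - exp (- c * real (num_draws \<Gamma>))"
      using \<Gamma> F arith
      by (intro order_trans[OF *[of \<Gamma> "F \<Gamma>"] measure_pmf.finite_measure_mono]) auto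
  qed
qed

section \<open>Complete bipartite instances\<close>

definition complete_instance :: "nat \<Rightarrow> (nat, nat) osm_instance" where
  "complete_instance n =
     \<lparr>advertisers = {..<n}, impressions = {..<n}, allowed = {..<n} \<times> {..<n}, expected = (\<lambda>_. 1)\<rparr>"

lemma complete_instance_simps [simp]:
  "advertisers (complete_instance n) = {..<n}" "impressions (complete_instance n) = {..<n}"
  "allowed (complete_instance n) = {..<n} \<times> {..<n}" "expected (complete_instance n) i = 1"
  "num_draws (complete_instance n) = n"
  by (simp_all add: complete_instance_def num_draws_def)

lemma valid_complete_instance: "n \<ge> 1 \<Longrightarrow> valid_instance (complete_instance n)"
  by (auto simp: valid_instance_def lessThan_empty_iff)

text \<open>Vertices of the realization graph are positions, so any \<open>n\<close> draws, repeated
  or not, yield a complete bipartite graph with a perfect matching.\<close>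

lemma OPT_complete_instance:
  assumes "n \<ge> 1" "js \<in> set_pmf (replicate_pmf n (draw_pmf (complete_instance n)))"
  shows "OPT (complete_instance n) js = n"
proof -
  have js: "length js = n" "set js \<subseteq> {..<n}"
    using assms by (auto simp: set_replicate_pmf set_pmf_iff
        pmf_draw_pmf[OF valid_complete_instance] split: if_splits)
  then have E: "realization_edges (complete_instance n) js = {..<n} \<times> {..<n}"
    by (auto simp: realization_edges_def) (meson lessThan_iff nth_mem subsetD)
  obtain M where M: "bipartite_matching ({..<n} \<times> {..<n}) M"
    "OPT (complete_instance n) js = card M"
    "\<And>M'. bipartite_matching ({..<n} \<times> {..<n}) M' \<Longrightarrow> card M' \<le> card M"
    using OPT_attained[OF valid_complete_instance[OF assms(1)], of js thesis] unfolding E by blast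
  have "card M \<le> card {..<n}"
    using M(1) by (intro card_inj_on_le[of fst]) (auto simp: bipartite_matching_def)
  moreover have "bipartite_matching ({..<n} \<times> {..<n}) ((\<lambda>j. (j, j)) ` {..<n})"
    by (auto simp: bipartite_matching_def inj_on_def)
  then have "card ((\<lambda>j. (j, j)) ` {..<n}) \<le> card M" by (rule M(3))
  ultimately show ?thesis
    using M(2) by (simp add: card_image inj_on_def)
qed

text \<open>A vertex cover of a complete bipartite graph contains one whole side, so the cover
  matching the flow has weight at least \<open>n\<close>.\<close>

lemma card_flow_advertisers_complete_instance:
  assumes "n \<ge> 1" "integral_max_flow (complete_instance n) f"
  shows "card (flow_advertisers (complete_instance n) f) = n"
proof -
  interpret integral_flow_instance "complete_instance n" f
    using assms by unfold_locales (auto simp: valid_complete_instance)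
  obtain B T where BT: "B \<subseteq> {..<n}" "T \<subseteq> {..<n}"
    "\<And>a i. a < n \<Longrightarrow> i < n \<Longrightarrow> a \<in> B \<or> i \<in> T"
    "card (flow_advertisers (complete_instance n) f) = card B + card T"
    using vertex_cover[of thesis] by auto
  have "B = {..<n} \<or> T = {..<n}" using BT(1-3) by blast
  then have "n \<le> card (flow_advertisers (complete_instance n) f)"
    using BT(4) by auto
  moreover have "card (flow_advertisers (complete_instance n) f) \<le> card {..<n}"
    by (intro card_mono) (auto simp: flow_advertisers_def)
  ultimately show ?thesis by simp
qed

lemma hit_probability_tendsto: "(\<lambda>n. 1 - (1 - 1 / real n) ^ n) \<longlonglongrightarrow> 1 - 1 / exp 1"
  using tendsto_diff[OF tendsto_const tendsto_exp_limit_sequentially[of "-1"], of 1]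
  by (simp add: exp_minus inverse_eq_divide)

lemma complete_instance_ALG_whp:
  assumes "\<epsilon> > 0"
  shows "\<exists>c>0. \<exists>N. \<forall>n\<ge>N. \<forall>f. integral_max_flow (complete_instance n) f \<longrightarrow>
     measure_pmf.prob (suggested_outcome_pmf (complete_instance n) f)
       {(js, ys). \<bar>real (ALG ys) - (1 - 1 / exp 1) * real n\<bar> \<le> \<epsilon> * real n}
     \<ge> 1 - exp (- c * real n)"
proof -
  obtain N0 where N0: "\<And>n. n \<ge> N0 \<Longrightarrow> \<bar>(1 - (1 - 1 / real n) ^ n) - (1 - 1 / exp 1)\<bar> < \<epsilon> / 2"
    using LIMSEQ_D[OF hit_probability_tendsto, of "\<epsilon> / 2"] assms by auto
  show ?thesis
  \<comment> \<open>Half of \<epsilon> pays for the deviation from the mean, half for the distance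
    of the mean from its limit. The threshold also excludes \<open>n = 0\<close>, where the instance
    is not valid.\<close>
  proof (intro exI[of _ "(\<epsilon> / 2)\<^sup>2"] conjI exI[of _ "max (max 1 N0) (nat \<lceil>1 / (\<epsilon> / 2)\<^sup>2\<rceil>)"] allI impI)
    fix n f
    assume n: "n \<ge> max (max 1 N0) (nat \<lceil>1 / (\<epsilon> / 2)\<^sup>2\<rceil>)"
      and f: "integral_max_flow (complete_instance n) f"
    then interpret integral_flow_instance "complete_instance n" f
      by unfold_locales (auto intro: valid_complete_instance)
    have near: "\<bar>(1 - 1 / exp 1) * real n - real n * (1 - (1 - 1 / real n) ^ n)\<bar> \<le> \<epsilon> / 2 * real n"
    proof -
      have "(1 - 1 / exp 1) * real n - real n * (1 - (1 - 1 / real n) ^ n) =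
          - ((1 - (1 - 1 / real n) ^ n) - (1 - 1 / exp 1)) * real n"
        by (simp add: algebra_simps)
      then have "\<bar>(1 - 1 / exp 1) * real n - real n * (1 - (1 - 1 / real n) ^ n)\<bar> =
          \<bar>(1 - (1 - 1 / real n) ^ n) - (1 - 1 / exp 1)\<bar> * real n"
        by (simp only: abs_mult abs_minus_cancel abs_of_nat)
      also have "\<dots> \<le> \<epsilon> / 2 * real n"
        using N0[of n] n by (intro mult_right_mono) auto
      finally show ?thesis .
    qed
    have card: "card (flow_advertisers (complete_instance n) f) = n"
      using n f by (intro card_flow_advertisers_complete_instance) auto
    have "1 - 2 * exp (- 2 * (\<epsilon> / 2)\<^sup>2 * real n) \<le>
        measure_pmf.prob (suggested_outcome_pmf (complete_instance n) f)
          {(js, ys). \<bar>real (ALG ys) - real n * (1 - (1 - 1 / real n) ^ n)\<bar> \<le> \<epsilon> / 2 * real n}"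
      using ALG_concentrated[of "\<epsilon> / 2"] assms by (simp add: card)
    also have "\<dots> \<le> measure_pmf.prob (suggested_outcome_pmf (complete_instance n) f)
        {(js, ys). \<bar>real (ALG ys) - (1 - 1 / exp 1) * real n\<bar> \<le> \<epsilon> * real n}"
    proof (intro measure_pmf.finite_measure_mono subsetI, safe)
      fix ys :: "nat option list"
      assume "\<bar>real (ALG ys) - real n * (1 - (1 - 1 / real n) ^ n)\<bar> \<le> \<epsilon> / 2 * real n"
      with near show "\<bar>real (ALG ys) - (1 - 1 / exp 1) * real n\<bar> \<le> \<epsilon> * real n"
        unfolding abs_le_iff by linarith
    qed simp
    finally show "measure_pmf.prob (suggested_outcome_pmf (complete_instance n) f)
          {(js, ys). \<bar>real (ALG ys) - (1 - 1 / exp 1) * real n\<bar> \<le> \<epsilon> * real n}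
        \<ge> 1 - exp (- ((\<epsilon> / 2)\<^sup>2) * real n)"
      using two_exp_le[of "\<epsilon> / 2" n] n assms by linarith
  qed (use assms in auto)
qed

text \<open>For \<open>n \<ge> 1\<close> the ratio is exactly \<open>1 - (1 - 1 / n) ^ n\<close>:
  \<open>OPT\<close> is \<open>n\<close> on the whole support and cancels against the number of
  advertisers carrying flow.\<close>

lemma complete_instance_ratio_tendsto:
  assumes F: "\<forall>n\<ge>1. integral_max_flow (complete_instance n) (F n)"
  shows "(\<lambda>n. measure_pmf.expectation (suggested_outcome_pmf (complete_instance n) (F n))
        (\<lambda>(js, ys). real (ALG ys)) /
      measure_pmf.expectation (suggested_outcome_pmf (complete_instance n) (F n))
        (\<lambda>(js, ys). real (OPT (complete_instance n) js))) \<longlonglongrightarrow> 1 - 1 / exp 1"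
proof (rule Lim_transform_eventually[OF hit_probability_tendsto])
  show "\<forall>\<^sub>F n in sequentially. 1 - (1 - 1 / real n) ^ n =
      measure_pmf.expectation (suggested_outcome_pmf (complete_instance n) (F n))
        (\<lambda>(js, ys). real (ALG ys)) /
      measure_pmf.expectation (suggested_outcome_pmf (complete_instance n) (F n))
        (\<lambda>(js, ys). real (OPT (complete_instance n) js))"
    using eventually_ge_at_top[of 1]
  proof eventually_elim
    case (elim n)
    then have f: "integral_max_flow (complete_instance n) (F n)" using F by blast
    interpret integral_flow_instance "complete_instance n" "F n"
      using elim f by unfold_locales (auto intro: valid_complete_instance)
    let ?P = "suggested_outcome_pmf (complete_instance n) (F n)"
    have "OPT (complete_instance n) js = n" if "(js, ys) \<in> set_pmf ?P" for js ys
      using that elim by (intro OPT_complete_instance) (auto simp: outcome_pmf_def)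
    then have "measure_pmf.expectation ?P (\<lambda>(js, ys). real (OPT (complete_instance n) js)) =
        measure_pmf.expectation ?P (\<lambda>_. real n)"
      by (intro integral_cong_AE) (auto simp: AE_measure_pmf_iff)
    then show ?case
      using elim by (simp add: expectation_ALG card_flow_advertisers_complete_instance[OF elim f])
  qed
qed

text \<open>Flows are quantified universally throughout, so guarantee and tightness hold for
  whichever integral maximum flow is computed.\<close>

theorem theorem2:
  shows
    "(\<forall>F :: ('a, 'i) osm_instance \<Rightarrow> ('a, 'i) net_flow.
        (\<forall>\<Gamma>. valid_instance \<Gamma> \<longrightarrow> integral_max_flow \<Gamma> (F \<Gamma>)) \<longrightarrow>
        achieves_factor_whp (\<lambda>\<Gamma>. suggested_matching \<Gamma> (F \<Gamma>) {}) (1 - 1 / exp 1)) \<and>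
     (\<forall>\<epsilon>>0. \<exists>c>0. \<exists>N. \<forall>(\<Gamma> :: ('a, 'i) osm_instance) f.
        valid_instance \<Gamma> \<and> integral_max_flow \<Gamma> f \<and> num_draws \<Gamma> \<ge> N \<longrightarrow>
        measure_pmf.prob (suggested_outcome_pmf \<Gamma> f)
          {(js, ys).
             real (ALG ys) \<ge> (1 - 1 / exp 1) * real (card (flow_advertisers \<Gamma> f))
                               - \<epsilon> * real (num_draws \<Gamma>) \<and>
             real (OPT \<Gamma> js) \<le> real (card (flow_advertisers \<Gamma> f)) + \<epsilon> * real (num_draws \<Gamma>)}
        \<ge> 1 - exp (- c * real (num_draws \<Gamma>))) \<and>
     (\<exists>K :: nat \<Rightarrow> (nat, nat) osm_instance.
        (\<forall>n\<ge>1. valid_instance (K n) \<and>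
           card (advertisers (K n)) = n \<and> card (impressions (K n)) = n \<and>
           allowed (K n) = advertisers (K n) \<times> impressions (K n) \<and>
           (\<forall>i\<in>impressions (K n). expected (K n) i = 1)) \<and>
        (\<forall>n\<ge>1. \<forall>js\<in>set_pmf (replicate_pmf (num_draws (K n)) (draw_pmf (K n))).
           OPT (K n) js = n) \<and>
        (\<forall>\<epsilon>>0. \<exists>c>0. \<exists>N. \<forall>n\<ge>N. \<forall>f. integral_max_flow (K n) f \<longrightarrow>
           measure_pmf.prob (suggested_outcome_pmf (K n) f)
             {(js, ys). \<bar>real (ALG ys) - (1 - 1 / exp 1) * real n\<bar> \<le> \<epsilon> * real n}
           \<ge> 1 - exp (- c * real n)) \<and>
        (\<forall>F. (\<forall>n\<ge>1. integral_max_flow (K n) (F n)) \<longrightarrow>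
           (\<lambda>n. measure_pmf.expectation (suggested_outcome_pmf (K n) (F n)) (\<lambda>(js, ys). real (ALG ys))
              / measure_pmf.expectation (suggested_outcome_pmf (K n) (F n)) (\<lambda>(js, ys). real (OPT (K n) js)))
           \<longlonglongrightarrow> 1 - 1 / exp 1))"
proof (intro conjI exI[of _ complete_instance] allI impI ballI, goal_cases)
  case 1
  then show ?case by (intro suggested_matching_achieves_factor) blast
next
  case 2
  then show ?case by (rule ALG_OPT_whp_uniform)
qed (use valid_complete_instance OPT_complete_instance complete_instance_ALG_whp
    complete_instance_ratio_tendsto in simp_all)

end
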